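(* Let $b\ge 2$ be an integer. For real $x\geq 0$ and integer $k\geq 3$, let $\beta(x)=\log_b((b^2-1)x+1)$ and \[f_k(x)=\frac{1}{\sqrt5}\left[(k-\beta(x))(\phi^{\beta(x)}+\phi^{-\beta(x)})+\phi^{\beta(x)+2}+\phi^{-\beta(x)-2}\right].\] If $k$ and $n$ are positive integers with $k\geq 3$ and $b^k<n\leq b^k+h_k$, then $s_b(n)<f_k(n-b^k)$.
   Context: Fix an integer $b\ge 2$. A base $b$ over-expansion of a positive integer $N$ is a word $d_kd_{k-1}\cdots d_0$ over $\{0,1,\ldots,b\}$ with $d_k\neq 0$ and $\sum_{i=0}^k d_ib^i=N$. For $n\ge 2$, $s_b(n)$ is the number of base $b$ over-expansions of $n-1$; $s_b(0)=0$, $s_b(1)=1$. The integers $h_m$ ($m\ge1$) are defined by $h_1=h_2=1$ and, for $m\geq 3$, $h_m=1+\sum_{i=0}^{\lfloor (m-3)/2\rfloor}b^{m-2-2i}$. Here $\phi=\frac{1+\sqrt5}{2}$. *)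

theory Defs
  imports Complex_Main
begin

text \<open>
  The word $d_k \cdots d_0$ is encoded as the list \<open>[d_0, \<dots>, d_k]\<close>, least significant
  digit first, so that \<open>ds ! i\<close> is $d_i$ and \<open>last ds\<close> is the leading digit $d_k$.
\<close>

definition over_expansions :: "nat \<Rightarrow> nat \<Rightarrow> nat list set" where
  "over_expansions b N =
     {ds. ds \<noteq> [] \<and> set ds \<subseteq> {0..b} \<and> last ds \<noteq> 0 \<and> (\<Sum>i<length ds. ds ! i * b ^ i) = N}"

definition over_count :: "nat \<Rightarrow> nat \<Rightarrow> nat" where
  "over_count b n = (if n = 0 then 0 else if n = 1 then 1 else card (over_expansions b (n - 1)))"

definition h_num :: "nat \<Rightarrow> nat \<Rightarrow> nat" where
  "h_num b m = (if m \<le> 2 then 1 else 1 + (\<Sum>i=0..(m - 3) div 2. b ^ (m - 2 - 2 * i)))"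

definition golden :: real where
  "golden = (1 + sqrt 5) / 2"

definition beta_log :: "nat \<Rightarrow> real \<Rightarrow> real" where
  "beta_log b x = log (real b) ((real b ^ 2 - 1) * x + 1)"

definition f_bound :: "nat \<Rightarrow> nat \<Rightarrow> real \<Rightarrow> real" where
  "f_bound b k x = 1 / sqrt 5 *
     ((real k - beta_log b x) * (golden powr beta_log b x + golden powr (- beta_log b x))
       + golden powr (beta_log b x + 2) + golden powr (- beta_log b x - 2))"

text \<open>The cardinality in the definition of \<open>over_count\<close> is a genuine count.\<close>

lemma finite_over_expansions:
  assumes "2 \<le> b"
  shows "finite (over_expansions b N)"
proof (rule finite_subset)
  show "over_expansions b N \<subseteq> {ds. set ds \<subseteq> {0..b} \<and> length ds \<le> Suc N}"
  proof
    fix ds assume ds: "ds \<in> over_expansions b N"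
    let ?k = "length ds - 1"
    from ds have ne: "ds \<noteq> []" and last: "last ds \<noteq> 0"
      and sum: "(\<Sum>i<length ds. ds ! i * b ^ i) = N"
      by (auto simp: over_expansions_def)
    have "?k < b ^ ?k" using assms by (intro power_gt_expt) auto
    also have "\<dots> \<le> ds ! ?k * b ^ ?k" using last ne by (simp add: last_conv_nth)
    also have "\<dots> \<le> N" unfolding sum[symmetric]
      by (rule member_le_sum[where f = "\<lambda>i. ds ! i * b ^ i"]) (use ne in auto)
    finally show "ds \<in> {ds. set ds \<subseteq> {0..b} \<and> length ds \<le> Suc N}"
      using ds by (auto simp: over_expansions_def)
  qed
qed (rule finite_lists_length_le, simp)

end

theory Submission
  imports Defs "HOL-Number_Theory.Fib" "HOL-Analysis.Harmonic_Numbers"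
begin

text \<open>
  Write $F_m$ for the Fibonacci numbers. On $n \le b^m$ the sequence is at most $F_{m+1}$, and
  $s_b(b^{j+1} + x) = s_b(b^j + x) + s_b(x)$ for $x \le b^j$. The broken line through the points
  $(h_m, F_m)$, $m \ge 2$, is concave. Since $h_{m+2} = b^m + h_m$, it follows inductively that
  $s_b$ lies below it, and therefore that $x \mapsto s_b(b^k + x)$ lies below the broken line
  through the points $(h_m, (k - m) F_m + F_{m+2})$, $2 \le m \le k$. The function $f_k$ is increasing
  and concave on $[1, h_k]$, and since $\beta(h_m) \ge m$, Binet's formula shows that it lies strictly
  above each of these points; hence it lies strictly above the broken line.
\<close>

section \<open>Recurrences\<close>

text \<open>
  Unlike \<open>over_expansions\<close>, this set contains the empty word when \<open>N = 0\<close>, so that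
  \<open>over_count b (Suc N) = card (digit_words b N)\<close> holds for every \<open>N\<close>.
\<close>

definition digit_words :: "nat \<Rightarrow> nat \<Rightarrow> nat list set" where
  "digit_words b N =
     {ds. set ds \<subseteq> {0..b} \<and> (ds = [] \<or> last ds \<noteq> 0) \<and> (\<Sum>i<length ds. ds ! i * b ^ i) = N}"

lemma digit_words_0:
  assumes "0 < b"
  shows "digit_words b 0 = {[]}"
proof -
  have "ds = []" if "ds \<in> digit_words b 0" for ds
  proof (rule ccontr)
    assume "ds \<noteq> []"
    with that assms show False by (auto simp: digit_words_def last_conv_nth)
  qed
  then show ?thesis by (auto simp: digit_words_def)
qed

lemma digit_words_pos:
  assumes "0 < N"
  shows "digit_words b N =
    (\<Union>(d, M) \<in> {(d, M). d \<le> b \<and> N = d + b * M}. (#) d ` digit_words b M)"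
    (is "_ = ?R")
proof (rule set_eqI)
  fix w
  show "w \<in> digit_words b N \<longleftrightarrow> w \<in> ?R"
  proof (cases w)
    case Nil
    with assms show ?thesis by (auto simp: digit_words_def)
  next
    case (Cons d ds)
    have "(\<Sum>i<length w. w ! i * b ^ i) = d + b * (\<Sum>i<length ds. ds ! i * b ^ i)"
      by (simp add: Cons sum.lessThan_Suc_shift sum_distrib_left mult_ac del: sum.lessThan_Suc)
    with Cons assms have "w \<in> digit_words b N
        \<longleftrightarrow> d \<le> b \<and> (\<exists>M. N = d + b * M \<and> ds \<in> digit_words b M)"
      by (auto simp: digit_words_def)
    with Cons show ?thesis by auto
  qed
qed

lemma finite_digit_words: "2 \<le> b \<Longrightarrow> finite (digit_words b N)"
proof (rule finite_subset)
  show "digit_words b N \<subseteq> insert [] (over_expansions b N)"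
    by (auto simp: digit_words_def over_expansions_def)
qed (simp add: finite_over_expansions)

lemma digit_add_mult_eq_iff:
  fixes b d r m M :: nat
  assumes "r < b"
  shows "d \<le> b \<and> r + b * m = d + b * M \<longleftrightarrow> d = r \<and> M = m \<or> d = b \<and> r = 0 \<and> m = Suc M"
proof -
  have unique: "r + b * m = e + b * L \<longleftrightarrow> e = r \<and> L = m" if "e < b" for e L
  proof
    assume eq: "r + b * m = e + b * L"
    from arg_cong[OF eq, of "\<lambda>n. n mod b"] arg_cong[OF eq, of "\<lambda>n. n div b"]
    show "e = r \<and> L = m" using that assms by simp
  qed simp
  consider "d < b" | "d = b" | "b < d" by linarith
  then show ?thesis
  proof cases
    case 1
    with unique[OF 1] show ?thesis by simp
  next
    case 2
    then have "r + b * m = d + b * M \<longleftrightarrow> r + b * m = 0 + b * Suc M" by simp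
    also have "\<dots> \<longleftrightarrow> 0 = r \<and> Suc M = m" using assms by (intro unique) simp
    finally show ?thesis using assms 2 by (simp only:) auto
  next
    case 3
    with assms show ?thesis by simp
  qed
qed

lemma digit_words_add_mult:
  assumes "0 < r" "r < b"
  shows "digit_words b (r + b * m) = (#) r ` digit_words b m"
proof -
  have "{(d, M). d \<le> b \<and> r + b * m = d + b * M} = {(r, m)}"
    using assms by (simp only: digit_add_mult_eq_iff) auto
  with assms show ?thesis by (simp add: digit_words_pos)
qed

lemma digit_words_mult_Suc:
  assumes "0 < b"
  shows "digit_words b (b * Suc m) = (#) 0 ` digit_words b (Suc m) \<union> (#) b ` digit_words b m"
proof -
  have "{(d, M). d \<le> b \<and> 0 + b * Suc m = d + b * M} = {(0, Suc m), (b, m)}"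
    using assms by (simp only: digit_add_mult_eq_iff) auto
  with assms show ?thesis by (simp add: digit_words_pos)
qed

lemma over_count_0 [simp]: "over_count b 0 = 0"
  by (simp add: over_count_def)

lemma over_count_Suc:
  assumes "0 < b"
  shows "over_count b (Suc N) = card (digit_words b N)"
proof (cases "N = 0")
  case True
  with assms show ?thesis by (simp add: over_count_def digit_words_0)
next
  case False
  then have "digit_words b N = over_expansions b N"
    by (auto simp: digit_words_def over_expansions_def)
  with False show ?thesis by (simp add: over_count_def)
qed

lemma over_count_1 [simp]: "over_count b (Suc 0) = 1"
  by (simp add: over_count_def)

lemma over_count_mult_add:
  assumes "2 \<le> r" "r \<le> b"
  shows "over_count b (b * m + r) = over_count b (m + 1)"
proof -
  obtain d where d: "r = Suc d" "0 < d" "d < b" using assms by (cases r) auto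
  have "over_count b (b * m + r) = card (digit_words b (d + b * m))"
    using d by (simp add: over_count_Suc add.commute)
  also have "\<dots> = over_count b (m + 1)"
    using d by (simp add: digit_words_add_mult over_count_Suc card_image)
  finally show ?thesis .
qed

lemma over_count_mult_add_1:
  assumes "2 \<le> b"
  shows "over_count b (b * m + 1) = over_count b m + over_count b (m + 1)"
proof (cases m)
  case (Suc i)
  have "card (digit_words b (b * m)) = card (digit_words b (Suc i)) + card (digit_words b i)"
    unfolding Suc using assms
    by (subst digit_words_mult_Suc, simp, subst card_Un_disjoint)
      (auto simp: finite_digit_words card_image)
  with Suc assms show ?thesis by (simp add: over_count_Suc)
qed simp

lemma over_count_mult:
  assumes "2 \<le> b"
  shows "over_count b (b * m) = over_count b m"
proof (cases m)
  case (Suc i)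
  with assms over_count_mult_add[of b b i] show ?thesis by (simp add: add.commute)
qed simp

lemma residue_cases:
  fixes b n :: nat
  assumes "2 \<le> b" "n \<noteq> 0"
  obtains (one) y where "n = b * y + 1" | (other) y r where "n = b * y + r" "2 \<le> r" "r \<le> b"
proof -
  define y r where "y = (n - 1) div b" and "r = (n - 1) mod b + 1"
  have "n = b * y + r" "1 \<le> r" "r \<le> b"
    using assms mult_div_mod_eq[of b "n - 1"] by (auto simp: y_def r_def Suc_le_eq)
  then show thesis using that by (cases "r = 1") auto
qed

lemma Suc_le_power_if_mult_add_le:
  fixes b y r m :: nat
  assumes "b * y + r \<le> b ^ Suc m" "0 < r"
  shows "y + 1 \<le> b ^ m"
proof -
  have "b * y < b * y + r" using assms(2) by simp
  also have "\<dots> \<le> b * b ^ m" using assms(1) by simp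
  finally show ?thesis by (simp add: Suc_le_eq)
qed

lemma over_count_le_add_Suc:
  assumes "2 \<le> b" "n \<le> b ^ Suc m"
  shows "\<exists>y. y + 1 \<le> b ^ m \<and> over_count b n \<le> over_count b y + over_count b (y + 1)"
proof (cases "n = 0")
  case True
  with assms show ?thesis by (intro exI[of _ 0]) simp
next
  case False
  with assms(1) show ?thesis
  proof (cases rule: residue_cases)
    case (one y)
    with assms over_count_mult_add_1[of b y] Suc_le_power_if_mult_add_le[of b y 1 m]
    show ?thesis by (intro exI[of _ y]) simp
  next
    case (other y r)
    with assms over_count_mult_add[of r b y] Suc_le_power_if_mult_add_le[of b y r m]
    show ?thesis by (intro exI[of _ y]) simp
  qed
qed

lemma over_count_add_Suc_le:
  assumes b: "2 \<le> b" and y: "y + 1 \<le> b ^ Suc m"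
  shows "\<exists>z w. z + 1 \<le> b ^ m \<and> w \<le> b ^ m \<and> over_count b y + over_count b (y + 1)
    \<le> over_count b z + over_count b (z + 1) + over_count b w"
proof -
  define z r where "z = y div b" and "r = y mod b"
  have y_eq: "y = b * z + r" and "r < b" using b by (simp_all add: z_def r_def)
  have z: "z + 1 \<le> b ^ m" using y y_eq Suc_le_power_if_mult_add_le[of b z "r + 1" m] by simp
  have count_y_1: "over_count b (y + 1) = over_count b (z + 1)" if "1 \<le> r"
    using over_count_mult_add[of "r + 1" b z] that y_eq \<open>r < b\<close> by (simp add: add.assoc)
  consider "r = 0" | "r = 1" | "2 \<le> r" by linarith
  then show ?thesis
  proof cases
    case 1
    with y_eq z over_count_mult[OF b, of z] over_count_mult_add_1[OF b, of z]
    show ?thesis by (intro exI[of _ z]) simp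
  next
    case 2
    with y_eq z count_y_1 over_count_mult_add_1[OF b, of z]
    show ?thesis by (intro exI[of _ z] exI[of _ "z + 1"]) simp
  next
    case 3
    then have "over_count b y = over_count b (z + 1)"
      using y_eq \<open>r < b\<close> by (simp add: over_count_mult_add)
    with 3 z count_y_1 show ?thesis by (intro exI[of _ z] exI[of _ "z + 1"]) simp
  qed
qed

lemma
  assumes b: "2 \<le> b"
  shows over_count_le_fib: "n \<le> b ^ m \<Longrightarrow> over_count b n \<le> fib (m + 1)"
    and over_count_add_Suc_le_fib:
      "n + 1 \<le> b ^ m \<Longrightarrow> over_count b n + over_count b (n + 1) \<le> fib (m + 2)"
proof (induction m arbitrary: n)
  case 0
  {
    case 1
    then show ?case by (auto simp: le_Suc_eq)
  next
    case 2
    then show ?case by simp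
  }
next
  case (Suc m)
  {
    case 1
    from over_count_le_add_Suc[OF b this] obtain y where "y + 1 \<le> b ^ m"
      and "over_count b n \<le> over_count b y + over_count b (y + 1)" by blast
    with Suc.IH(2)[of y] show ?case by simp
  next
    case 2
    from over_count_add_Suc_le[OF b this] obtain z w where "z + 1 \<le> b ^ m" "w \<le> b ^ m"
      and "over_count b n + over_count b (n + 1)
        \<le> over_count b z + over_count b (z + 1) + over_count b w" by blast
    with Suc.IH(1)[of w] Suc.IH(2)[of z] show ?case by simp
  }
qed

lemma over_count_power_add_le_fib:
  assumes b: "2 \<le> b" and x: "x \<le> b ^ m"
  shows "over_count b (b ^ m + x) \<le> fib (m + 2)"
proof -
  have "b ^ m + x \<le> 2 * b ^ m" using x by simp
  also have "\<dots> \<le> b ^ (m + 1)" using b by simp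
  finally show ?thesis using over_count_le_fib[OF b, of "b ^ m + x" "m + 1"] by simp
qed

lemma over_count_power_Suc_add:
  assumes b: "2 \<le> b"
  shows "x \<le> b ^ j \<Longrightarrow> over_count b (b ^ Suc j + x) = over_count b (b ^ j + x) + over_count b x"
proof (induction j arbitrary: x)
  case 0
  then consider "x = 0" | "x = 1" by (auto simp: le_Suc_eq)
  then show ?case
    using over_count_mult[OF b, of 1] over_count_mult_add_1[OF b, of 1] by cases simp_all
next
  case (Suc j)
  show ?case
  proof (cases "x = 0")
    case True
    with over_count_mult[OF b, of "b ^ Suc j"] show ?thesis by simp
  next
    case False
    with b show ?thesis
    proof (cases rule: residue_cases)
      case (one y)
      then have "y + 1 \<le> b ^ j" using Suc.prems Suc_le_power_if_mult_add_le[of b y 1 j] by simp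
      moreover have "b ^ Suc i + x = b * (b ^ i + y) + 1" for i
        using one by (simp add: algebra_simps)
      ultimately show ?thesis using Suc.IH[of y] Suc.IH[of "y + 1"] one
        by (simp only: over_count_mult_add_1[OF b] add.assoc)
    next
      case (other y r)
      then have "y + 1 \<le> b ^ j" using Suc.prems Suc_le_power_if_mult_add_le[of b y r j] by simp
      moreover have "b ^ Suc i + x = b * (b ^ i + y) + r" for i
        using other by (simp add: algebra_simps)
      ultimately show ?thesis using Suc.IH[of "y + 1"] other
        by (simp only: over_count_mult_add add.assoc)
    qed
  qed
qed

lemma over_count_power_add:
  assumes b: "2 \<le> b" and x: "x \<le> b ^ m" and "m \<le> k"
  shows "over_count b (b ^ k + x) = over_count b (b ^ m + x) + (k - m) * over_count b x"
  using \<open>m \<le> k\<close>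
proof (induction k rule: dec_induct)
  case (step k)
  have "b ^ m \<le> b ^ k" using step b by (intro power_increasing) auto
  with x have "x \<le> b ^ k" by (rule order.trans)
  from over_count_power_Suc_add[OF b this] step show ?case by (simp add: Suc_diff_le)
qed simp

section \<open>The numbers $h_m$\<close>

lemma h_num_pos: "1 \<le> h_num b m"
  by (simp add: h_num_def)

lemma h_num_le_2: "m \<le> 2 \<Longrightarrow> h_num b m = 1"
  by (simp add: h_num_def)

lemma h_num_add_2:
  assumes "1 \<le> m"
  shows "h_num b (m + 2) = b ^ m + h_num b m"
proof (cases "m \<le> 2")
  case True
  with assms have "m = 1 \<or> m = 2" by auto
  then show ?thesis by (auto simp: h_num_def)
next
  case False
  then obtain n where m: "m = n + 3" using le_Suc_ex[of 3 m] by (auto simp: add.commute)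
  have "(\<Sum>i=0..Suc (n div 2). b ^ (n + 3 - 2 * i))
      = b ^ (n + 3) + (\<Sum>i=0..n div 2. b ^ (n + 1 - 2 * i))"
    by (simp only: sum.atLeast0_atMost_Suc_shift) simp
  then show ?thesis by (simp add: m h_num_def add.commute)
qed

lemma h_num_closed_form:
  assumes "1 \<le> m"
  shows "(real b ^ 2 - 1) * real (h_num b m) + 1
    = real b ^ m + (if even m then 0 else real b ^ 2 - real b)"
proof -
  have "(real b ^ 2 - 1) * real (h_num b (Suc i)) + 1
      = real b ^ Suc i + (if even i then real b ^ 2 - real b else 0)" for i
  proof (induction i rule: induct_nat_012)
    case (ge2 i)
    have "real (h_num b (Suc (Suc (Suc i)))) = real b ^ Suc i + real (h_num b (Suc i))"
      using h_num_add_2[of "Suc i" b] by simp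
    then show ?case using ge2(1) by (simp add: algebra_simps power2_eq_square split: if_splits)
  qed (simp_all add: h_num_le_2 power2_eq_square)
  from this[of "m - 1"] assms show ?thesis by simp
qed

lemma h_num_Suc_le_power:
  assumes "2 \<le> b"
  shows "h_num b (Suc m) \<le> b ^ m"
proof (induction m rule: induct_nat_012)
  case (ge2 m)
  have "h_num b (Suc (Suc (Suc m))) = b ^ Suc m + h_num b (Suc m)"
    using h_num_add_2[of "Suc m" b] by simp
  also have "\<dots> \<le> b ^ Suc m + b ^ Suc m"
    using order.trans[OF ge2(1) power_increasing[of m "Suc m" b]] assms by simp
  also have "\<dots> = 2 * b ^ Suc m" by simp
  also have "\<dots> \<le> b * b ^ Suc m" using assms by (rule mult_right_mono) simp
  also have "\<dots> = b ^ Suc (Suc m)" by simp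
  finally show ?case .
qed (use assms in \<open>simp_all add: h_num_le_2\<close>)

definition h_gap :: "nat \<Rightarrow> nat \<Rightarrow> real" where
  "h_gap b m = real (h_num b (Suc m)) - real (h_num b m)"

lemma h_gap_add_h_gap_Suc:
  assumes "1 \<le> m"
  shows "h_gap b m + h_gap b (Suc m) = real b ^ m"
  using h_num_add_2[OF assms, of b] by (simp add: h_gap_def)

lemma h_gap_closed_form:
  assumes b: "2 \<le> b" and m: "1 \<le> m"
  shows "(real b + 1) * h_gap b m = real b ^ m + (if even m then real b else - real b)"
proof -
  have "(real b - 1) * ((real b + 1) * h_gap b m)
      = ((real b ^ 2 - 1) * real (h_num b (Suc m)) + 1) - ((real b ^ 2 - 1) * real (h_num b m) + 1)"
    by (simp add: h_gap_def algebra_simps power2_eq_square)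
  also have "\<dots> = (real b - 1) * (real b ^ m + (if even m then real b else - real b))"
    using m by (simp add: h_num_closed_form) (simp add: algebra_simps power2_eq_square)
  finally show ?thesis using b by simp
qed

lemma h_gap_pos:
  assumes "2 \<le> b" "2 \<le> m"
  shows "0 < h_gap b m"
proof -
  have "real b ^ 1 < real b ^ m" using assms by (intro power_strict_increasing) auto
  with assms have "0 < (real b + 1) * h_gap b m"
    by (subst h_gap_closed_form) (auto intro: add_pos_pos)
  then show ?thesis by (simp add: zero_less_mult_iff)
qed

lemma h_num_mono:
  assumes "2 \<le> b" "2 \<le> m" "m \<le> n"
  shows "h_num b m \<le> h_num b n"
  using assms(3)
proof (induction n rule: dec_induct)
  case (step n)
  with h_gap_pos[of b n] assms show ?case by (simp add: h_gap_def)
qed simp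

lemma h_num_interval:
  assumes "3 \<le> j" "1 \<le> x" "x \<le> h_num b j"
  shows "\<exists>m. 2 \<le> m \<and> m < j \<and> h_num b m \<le> x \<and> x \<le> h_num b (Suc m)"
  using assms(1,3)
proof (induction j rule: dec_induct)
  case base
  with assms(2) show ?case by (intro exI[of _ 2]) (simp add: h_num_le_2)
next
  case (step j)
  show ?case
  proof (cases "x \<le> h_num b j")
    case True
    with step.IH show ?thesis by (meson less_SucI)
  next
    case False
    with step show ?thesis by (intro exI[of _ j]) auto
  qed
qed

section \<open>The broken line through the points $(h_m, F_m)$\<close>

definition chord :: "nat \<Rightarrow> (nat \<Rightarrow> real) \<Rightarrow> nat \<Rightarrow> real \<Rightarrow> real" where
  "chord b v m x =
     (v m * (real (h_num b (Suc m)) - x) + v (Suc m) * (x - real (h_num b m))) / h_gap b m"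

lemma chord_mono:
  assumes "2 \<le> b" "2 \<le> m" "real (h_num b m) \<le> x" "x \<le> real (h_num b (Suc m))"
    and "v m \<le> w m" "v (Suc m) \<le> w (Suc m)"
  shows "chord b v m x \<le> chord b w m x"
  unfolding chord_def using assms h_gap_pos[of b m]
  by (intro divide_right_mono add_mono mult_right_mono) auto

lemma chord_strict_mono:
  assumes "2 \<le> b" "2 \<le> m" "real (h_num b m) \<le> x" "x \<le> real (h_num b (Suc m))"
    and "v m < w m" "v (Suc m) < w (Suc m)"
  shows "chord b v m x < chord b w m x"
proof -
  have gap: "0 < h_gap b m" using assms by (intro h_gap_pos)
  have "v m * (real (h_num b (Suc m)) - x) + v (Suc m) * (x - real (h_num b m))
      < w m * (real (h_num b (Suc m)) - x) + w (Suc m) * (x - real (h_num b m))"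
  proof (cases "x = real (h_num b m)")
    case True
    with gap assms show ?thesis by (simp add: h_gap_def)
  next
    case False
    with assms show ?thesis by (intro add_le_less_mono mult_right_mono mult_strict_right_mono) auto
  qed
  with gap show ?thesis unfolding chord_def by (intro divide_strict_right_mono)
qed

lemma chord_affine:
  assumes "2 \<le> b" "2 \<le> m"
  shows "chord b (\<lambda>i. a + c * real (h_num b i)) m x = a + c * x"
proof -
  have "(a + c * real (h_num b m)) * (real (h_num b (Suc m)) - x)
      + (a + c * real (h_num b (Suc m))) * (x - real (h_num b m)) = (a + c * x) * h_gap b m"
    by (simp add: h_gap_def algebra_simps)
  with h_gap_pos[OF assms] show ?thesis by (simp add: chord_def)
qed

definition fib_slope :: "nat \<Rightarrow> nat \<Rightarrow> real" where
  "fib_slope b m = real (fib (m - 1)) / h_gap b m"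

lemma fib_slope_nonneg:
  assumes "2 \<le> b" "2 \<le> m"
  shows "0 \<le> fib_slope b m"
  using h_gap_pos[OF assms] by (simp add: fib_slope_def)

lemma fib_Suc_eq_slope:
  assumes "2 \<le> b" "2 \<le> m"
  shows "real (fib (Suc m)) = real (fib m) + fib_slope b m * h_gap b m"
proof -
  have "fib (Suc m) = fib m + fib (m - 1)" using assms by (cases m) auto
  with h_gap_pos[OF assms] show ?thesis by (simp add: fib_slope_def)
qed

lemma chord_fib:
  assumes "2 \<le> b" "2 \<le> m"
  shows "chord b (\<lambda>i. real (fib i)) m x
    = real (fib (Suc m)) - fib_slope b m * (real (h_num b (Suc m)) - x)"
proof -
  define a where "a = real (fib (Suc m)) - fib_slope b m * real (h_num b (Suc m))"
  have "chord b (\<lambda>i. real (fib i)) m x = chord b (\<lambda>i. a + fib_slope b m * real (h_num b i)) m x"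
    using fib_Suc_eq_slope[OF assms] by (simp add: chord_def a_def h_gap_def algebra_simps)
  also have "\<dots> = a + fib_slope b m * x" by (rule chord_affine[OF assms])
  finally show ?thesis by (simp add: a_def algebra_simps)
qed

lemma fib_add_2_le:
  assumes "1 \<le> i"
  shows "fib (i + 2) \<le> 3 * fib i"
proof -
  obtain l where "i = Suc l" using assms by (cases i) auto
  with fib_Suc_mono[of l] show ?thesis by simp
qed

lemma fib_add_4_le:
  assumes "1 \<le> i"
  shows "fib (i + 4) + fib i = 3 * fib (i + 2)" "fib (i + 4) \<le> 8 * fib i"
proof -
  obtain l where "i = Suc l" using assms by (cases i) auto
  with fib_Suc_mono[of l]
  show "fib (i + 4) + fib i = 3 * fib (i + 2)" "fib (i + 4) \<le> 8 * fib i"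
    by (simp_all add: numeral_eq_Suc)
qed

lemma fib_add_2_mult_power_add_le:
  assumes b: "2 \<le> b" and "odd i"
  shows "fib (i + 2) * (b ^ Suc i + b) \<le> (b + 1) * fib i * b ^ Suc i"
proof (cases "i = 1")
  case True
  have "(b + 1) * (2 * b) \<le> (b + 1) * (b * b)"
    using b by (intro mult_left_mono mult_right_mono) auto
  with True show ?thesis by (simp add: algebra_simps numeral_eq_Suc)
next
  case False
  with \<open>odd i\<close> have "3 \<le> i" by presburger
  then obtain l where l: "i = l + 2" "1 \<le> l"
    using le_Suc_ex[of 3 i] by (auto simp: numeral_eq_Suc)
  have "8 * b \<le> b ^ 3 * b" using b power_mono[of 2 b 3] by (intro mult_right_mono) auto
  also have "\<dots> = b ^ 4" by (simp add: numeral_eq_Suc)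
  also have "\<dots> \<le> b ^ Suc i" using b l by (intro power_increasing) auto
  finally have power: "8 * b \<le> b ^ Suc i" .
  have "fib (l + 4) * b \<le> 8 * fib l * b"
    using fib_add_4_le(2)[OF l(2)] by (intro mult_right_mono) auto
  also have "\<dots> = fib l * (8 * b)" by simp
  also have "\<dots> \<le> fib l * b ^ Suc i" using power by (rule mult_left_mono) simp
  finally have "fib (l + 4) * (b ^ Suc i + b) \<le> (fib (l + 4) + fib l) * b ^ Suc i"
    by (simp add: algebra_simps del: power_Suc)
  also have "\<dots> = 3 * fib i * b ^ Suc i" using fib_add_4_le(1)[OF l(2)] l by simp
  also have "\<dots> \<le> (b + 1) * fib i * b ^ Suc i" using b by (intro mult_right_mono) auto
  finally show ?thesis using l by (simp add: numeral_eq_Suc)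
qed

lemma fib_mult_h_gap_le:
  assumes b: "2 \<le> b" and i: "1 \<le> i"
  shows "real (fib (i + 2)) * h_gap b (Suc i) \<le> real (fib i) * real b ^ Suc i"
proof -
  have "(real b + 1) * (real (fib (i + 2)) * h_gap b (Suc i))
      = real (fib (i + 2)) * (real b ^ Suc i + (if odd i then real b else - real b))"
    using h_gap_closed_form[OF b, of "Suc i"] by simp
  also have "\<dots> \<le> (real b + 1) * (real (fib i) * real b ^ Suc i)"
  proof (cases "odd i")
    case True
    have "real (fib (i + 2) * (b ^ Suc i + b)) \<le> real ((b + 1) * fib i * b ^ Suc i)"
      using fib_add_2_mult_power_add_le[OF b True] by (rule of_nat_mono)
    with True show ?thesis by (simp add: algebra_simps)
  next
    case False
    have "real (fib (i + 2)) * (real b ^ Suc i - real b) \<le> real (fib (i + 2)) * real b ^ Suc i"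
      by (intro mult_left_mono) auto
    also have "\<dots> \<le> (3 * real (fib i)) * real b ^ Suc i"
      using fib_add_2_le[OF i] by (intro mult_right_mono) auto
    also have "\<dots> \<le> ((real b + 1) * real (fib i)) * real b ^ Suc i"
      using b by (intro mult_right_mono) auto
    finally show ?thesis using False by simp
  qed
  finally show ?thesis by (simp add: mult_le_cancel_left)
qed

lemma fib_slope_antimono:
  assumes b: "2 \<le> b" and m: "2 \<le> m" "m \<le> n"
  shows "fib_slope b n \<le> fib_slope b m"
  using m(2)
proof (induction n rule: dec_induct)
  case (step n)
  obtain i where i: "n = Suc i" "1 \<le> i" using m step by (cases n) auto
  have gaps: "0 < h_gap b n" "0 < h_gap b (Suc n)" using b m step by (auto intro: h_gap_pos)
  have "real (fib n) * h_gap b n + real (fib i) * h_gap b n \<le> real (fib i) * real b ^ n"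
    using fib_mult_h_gap_le[OF b i(2)] i(1) by (simp add: algebra_simps)
  also have "real b ^ n = h_gap b n + h_gap b (Suc n)"
    using h_gap_add_h_gap_Suc[of n b] i by simp
  finally have "real (fib n) * h_gap b n \<le> real (fib i) * h_gap b (Suc n)"
    by (simp add: algebra_simps)
  with gaps i(1) have "fib_slope b (Suc n) \<le> fib_slope b n"
    by (simp add: fib_slope_def field_simps)
  with step.IH show ?case by simp
qed simp

text \<open>
  \<open>knot_value k m\<close> is the height at \<open>x = h_m\<close> of the broken line bounding \<open>s_b (b ^ k + x)\<close>.
\<close>

definition knot_value :: "nat \<Rightarrow> nat \<Rightarrow> real" where
  "knot_value k m = (real k - real m) * real (fib m) + real (fib (m + 2))"

lemma knot_value_Suc:
  "knot_value k (Suc m) = (real k - real m) * real (fib (Suc m)) + real (fib (m + 2))"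
  by (simp add: knot_value_def algebra_simps)

lemma chord_knot_value:
  assumes "2 \<le> b" "2 \<le> m"
  shows "chord b (knot_value k) m x
    = (real k - real m) * chord b (\<lambda>i. real (fib i)) m x + real (fib (m + 2))"
proof -
  have "chord b (knot_value k) m x = (real k - real m) * chord b (\<lambda>i. real (fib i)) m x
      + chord b (\<lambda>i. real (fib (m + 2)) + 0 * real (h_num b i)) m x"
    unfolding chord_def knot_value_Suc
    by (simp add: knot_value_def algebra_simps add_divide_distrib diff_divide_distrib)
  then show ?thesis by (simp only: chord_affine[OF assms])
qed

lemma over_count_power_add_le_chord:
  assumes b: "2 \<le> b" and m: "2 \<le> m" "m \<le> k" and x: "x \<le> h_num b (Suc m)"
    and chord: "real (over_count b x) \<le> chord b (\<lambda>i. real (fib i)) m (real x)"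
  shows "real (over_count b (b ^ k + x)) \<le> chord b (knot_value k) m (real x)"
proof -
  have xb: "x \<le> b ^ m" using x h_num_Suc_le_power[OF b] by (rule order.trans)
  then have "over_count b (b ^ m + x) \<le> fib (m + 2)" by (rule over_count_power_add_le_fib[OF b])
  moreover have "(real k - real m) * real (over_count b x)
      \<le> (real k - real m) * chord b (\<lambda>i. real (fib i)) m (real x)"
    using chord m by (intro mult_left_mono) auto
  ultimately show ?thesis
    unfolding over_count_power_add[OF b xb m(2)] chord_knot_value[OF b m(1)]
    using m by simp
qed

lemma knot_value_le_line:
  assumes b: "2 \<le> b" and m: "2 \<le> m" "m \<le> k"
  shows "knot_value k m
    \<le> real (fib (k + 2)) - fib_slope b (Suc k) * (real (h_num b k) - real (h_num b m))"
  using m(2)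
proof (induction m rule: inc_induct)
  case base
  show ?case by (simp add: knot_value_def)
next
  case (step i)
  have i: "2 \<le> i" "Suc i \<le> k" using m step by auto
  have "fib_slope b (Suc k) \<le> 1 * fib_slope b i"
    using fib_slope_antimono[OF b i(1), of "Suc k"] i by simp
  also have "\<dots> \<le> (real k - real i) * fib_slope b i"
    using fib_slope_nonneg[OF b i(1)] i(2) by (intro mult_right_mono) auto
  finally have "fib_slope b (Suc k) * h_gap b i \<le> (real k - real i) * fib_slope b i * h_gap b i"
    using h_gap_pos[OF b i(1)] by (intro mult_right_mono) auto
  also have "\<dots> = knot_value k (Suc i) - knot_value k i"
    unfolding knot_value_Suc fib_Suc_eq_slope[OF b i(1)] by (simp add: knot_value_def algebra_simps)
  finally show ?case using step.IH by (simp add: h_gap_def algebra_simps)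
qed

lemma over_count_power_add_le_line:
  assumes b: "2 \<le> b" and x: "1 \<le> x" "x \<le> h_num b k"
    and chord: "\<And>m. 2 \<le> m \<Longrightarrow> m < k \<Longrightarrow> h_num b m \<le> x \<Longrightarrow> x \<le> h_num b (Suc m) \<Longrightarrow>
      real (over_count b x) \<le> chord b (\<lambda>i. real (fib i)) m (real x)"
  shows "real (over_count b (b ^ k + x))
    \<le> real (fib (k + 2)) - fib_slope b (Suc k) * (real (h_num b k) - real x)"
proof (cases "3 \<le> k")
  case True
  define line where
    "line z = real (fib (k + 2)) - fib_slope b (Suc k) * (real (h_num b k) - z)" for z
  from h_num_interval[OF True x] obtain m
    where m: "2 \<le> m" "m < k" and x_m: "h_num b m \<le> x" "x \<le> h_num b (Suc m)" by blast
  then have "real (over_count b (b ^ k + x)) \<le> chord b (knot_value k) m (real x)"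
    by (intro over_count_power_add_le_chord[OF b] chord) auto
  also have "\<dots> \<le> chord b (\<lambda>i. line (real (h_num b i))) m (real x)"
    unfolding line_def using b m x_m by (intro chord_mono knot_value_le_line) auto
  also have "\<dots> = line (real x)"
    using chord_affine[OF b m(1), of "line 0" "fib_slope b (Suc k)" "real x"]
    by (simp add: line_def algebra_simps)
  finally show ?thesis by (simp add: line_def)
next
  case False
  with x have "x = 1" "h_num b k = 1" by (simp_all add: h_num_le_2)
  moreover have "over_count b (b ^ k + 1) \<le> fib (k + 2)"
    using b by (intro over_count_power_add_le_fib) auto
  ultimately show ?thesis by simp
qed

lemma over_count_le_chord:
  assumes b: "2 \<le> b"
  shows "2 \<le> m \<Longrightarrow> h_num b m \<le> x \<Longrightarrow> x \<le> h_num b (Suc m) \<Longrightarrow>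
    real (over_count b x) \<le> chord b (\<lambda>i. real (fib i)) m (real x)"
proof (induction m arbitrary: x rule: less_induct)
  case (less m)
  obtain j where j: "m = Suc j" "1 \<le> j" using less.prems(1) by (cases m) auto
  have h_Suc: "h_num b (Suc m) = b ^ j + h_num b j" using h_num_add_2[of j b] j by simp
  show ?case
  proof (cases "x \<le> b ^ j")
    case True
    then have "real (over_count b x) \<le> real (fib m)" using over_count_le_fib[OF b True] j by simp
    also have "\<dots> = chord b (\<lambda>i. real (fib m) + 0 * real (h_num b i)) m (real x)"
      by (simp only: chord_affine[OF b less.prems(1)])
    also have "\<dots> \<le> chord b (\<lambda>i. real (fib i)) m (real x)"
      using less.prems b fib_Suc_mono[of m] by (intro chord_mono) auto
    finally show ?thesis .
  next
    case False
    define y where "y = x - b ^ j"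
    have y: "1 \<le> y" "y \<le> h_num b j" "x = b ^ j + y"
      using False less.prems(3) h_Suc by (auto simp: y_def)
    have "real (over_count b x)
        \<le> real (fib (j + 2)) - fib_slope b (Suc j) * (real (h_num b j) - real y)"
      unfolding y(3) using y j by (intro over_count_power_add_le_line[OF b] less.IH) auto
    also have "\<dots> = chord b (\<lambda>i. real (fib i)) m (real x)"
      unfolding chord_fib[OF b less.prems(1)] using j h_Suc y(3) by simp
    finally show ?thesis .
  qed
qed

section \<open>Growth and concavity of the bounding function\<close>

lemma sqrt_5_bounds: "2236 / 1000 \<le> sqrt 5" "sqrt 5 \<le> 2237 / 1000"
  by (rule real_le_rsqrt real_le_lsqrt; simp add: power2_eq_square)+

lemma golden_gt_1: "1 < golden"
  using sqrt_5_bounds by (simp add: golden_def)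

lemma inverse_golden: "inverse golden = golden - 1"
  by (rule inverse_unique) (simp add: golden_def field_simps)

lemma ln_golden_bounds: "47 / 100 \<le> ln golden" "ln golden \<le> 49 / 100"
proof -
  define y where "y = sqrt 5 - 2"
  define q where "q = y ^ 3 / (1 - y\<^sup>2)"
  have y: "236 / 1000 \<le> y" "y \<le> 237 / 1000" using sqrt_5_bounds by (simp_all add: y_def)
  have "golden - 1 = y * (golden + 1)" by (simp add: y_def golden_def field_simps)
  then have "(golden - 1) / (golden + 1) = y" using golden_gt_1 by simp
  then have ln: "2 * y \<le> ln golden" "ln golden \<le> 2 * y + 2 / 3 * q"
    using ln_approx_bounds[of golden 1] golden_gt_1
    by (simp_all add: numeral_eq_Suc q_def mult.commute)
  have "y ^ 3 \<le> (237 / 1000) ^ 3" "y\<^sup>2 \<le> (237 / 1000)\<^sup>2"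
    using y by (intro power_mono; simp)+
  then have "q \<le> (1 / 50) / (9 / 10)"
    unfolding q_def by (intro frac_le) (simp_all add: power2_eq_square power3_eq_cube)
  with ln y show "47 / 100 \<le> ln golden" "ln golden \<le> 49 / 100" by simp_all
qed

definition golden_sum :: "real \<Rightarrow> real" where
  "golden_sum t = golden powr t + golden powr (- t)"

definition golden_diff :: "real \<Rightarrow> real" where
  "golden_diff t = golden powr t - golden powr (- t)"

lemma golden_powr_eq_exp: "golden powr t = exp (t * ln golden)"
  using golden_gt_1 by (simp add: powr_def)

lemma golden_powr_add_2:
  "golden powr (t + 2) = (3 + sqrt 5) / 2 * golden powr t"
  "golden powr (- (t + 2)) = (3 - sqrt 5) / 2 * golden powr (- t)"
proof -
  have 2: "golden powr 2 = (3 + sqrt 5) / 2"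
    using golden_gt_1 by (simp add: golden_def power2_eq_square field_simps)
  have "golden powr - 2 = (3 - sqrt 5) / 2"
    unfolding powr_minus 2 by (rule inverse_unique) (simp add: field_simps)
  with 2 show "golden powr (t + 2) = (3 + sqrt 5) / 2 * golden powr t"
    "golden powr (- (t + 2)) = (3 - sqrt 5) / 2 * golden powr (- t)"
    using powr_add[of golden "- t" "- 2"] by (simp_all add: powr_add)
qed

lemma golden_sum_add_2: "golden_sum (t + 2) = (3 * golden_sum t + sqrt 5 * golden_diff t) / 2"
  and golden_diff_add_2: "golden_diff (t + 2) = (3 * golden_diff t + sqrt 5 * golden_sum t) / 2"
  unfolding golden_sum_def golden_diff_def golden_powr_add_2 by (simp_all add: field_simps)

lemma golden_sum_pos: "0 < golden_sum t"
  using golden_gt_1 by (simp add: golden_sum_def add_pos_pos)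

lemma golden_diff_nonneg:
  assumes "0 \<le> t"
  shows "0 \<le> golden_diff t"
  using assms golden_gt_1 by (simp add: golden_diff_def)

lemma golden_diff_mult_sum_mono:
  assumes "s \<le> t"
  shows "golden_diff s * golden_sum t \<le> golden_diff t * golden_sum s"
proof -
  have "golden_diff t * golden_sum s - golden_diff s * golden_sum t = 2 * golden_diff (t - s)"
    using golden_gt_1
    by (simp add: golden_diff_def golden_sum_def powr_diff powr_minus field_simps)
  with golden_diff_nonneg[of "t - s"] assms show ?thesis by simp
qed

lemma golden_sum_le_diff_2:
  assumes "2 \<le> t"
  shows "sqrt 5 * golden_sum t \<le> 3 * golden_diff t"
proof -
  have "golden_sum 0 = 2" "golden_diff 0 = 0"
    using golden_gt_1 by (simp_all add: golden_sum_def golden_diff_def)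
  then have "golden_sum 2 = 3" "golden_diff 2 = sqrt 5"
    using golden_sum_add_2[of 0] golden_diff_add_2[of 0] by simp_all
  with golden_diff_mult_sum_mono[OF assms] show ?thesis by simp
qed

lemma golden_sum_le_diff_3:
  assumes "3 \<le> t"
  shows "2 * golden_sum t \<le> sqrt 5 * golden_diff t"
proof -
  have "golden powr - 1 = golden - 1" using golden_gt_1 by (simp add: powr_minus inverse_golden)
  then have "golden_sum 1 = sqrt 5" "golden_diff 1 = 1"
    using golden_gt_1
    by (simp_all add: golden_sum_def golden_diff_def) (simp add: golden_def field_simps)
  then have "golden_sum 3 = 2 * sqrt 5" "golden_diff 3 = 4"
    using golden_sum_add_2[of 1] golden_diff_add_2[of 1] by simp_all
  with golden_diff_mult_sum_mono[OF assms] show ?thesis by (simp add: mult.commute)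
qed

lemma golden_sum_has_real_derivative [derivative_intros]:
  assumes "(f has_real_derivative f') (at x within A)"
  shows "((\<lambda>x. golden_sum (f x)) has_real_derivative ln golden * golden_diff (f x) * f')
    (at x within A)"
  unfolding golden_sum_def golden_diff_def golden_powr_eq_exp
  by (auto intro!: derivative_eq_intros assms simp: algebra_simps)

lemma golden_diff_has_real_derivative [derivative_intros]:
  assumes "(f has_real_derivative f') (at x within A)"
  shows "((\<lambda>x. golden_diff (f x)) has_real_derivative ln golden * golden_sum (f x) * f')
    (at x within A)"
  unfolding golden_sum_def golden_diff_def golden_powr_eq_exp
  by (auto intro!: derivative_eq_intros assms simp: algebra_simps)

definition growth :: "real \<Rightarrow> real \<Rightarrow> real" where
  "growth k t = (k - t) * golden_sum t + golden_sum (t + 2)"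

definition growth' :: "real \<Rightarrow> real \<Rightarrow> real" where
  "growth' k t = ln golden * ((k - t) * golden_diff t + golden_diff (t + 2)) - golden_sum t"

definition growth'' :: "real \<Rightarrow> real \<Rightarrow> real" where
  "growth'' k t = ln golden * (ln golden * growth k t - 2 * golden_diff t)"

lemma f_bound_eq_growth: "f_bound b k x = growth (real k) (beta_log b x) / sqrt 5"
proof -
  have "- beta_log b x - 2 = - (beta_log b x + 2)" by simp
  then show ?thesis by (simp only: f_bound_def growth_def golden_sum_def) simp
qed

lemma DERIV_growth: "(growth k has_real_derivative growth' k t) (at t)"
  unfolding growth_def[abs_def] growth'_def
  by (auto intro!: derivative_eq_intros simp: algebra_simps)

lemma DERIV_growth': "(growth' k has_real_derivative growth'' k t) (at t)"
  unfolding growth'_def[abs_def] growth''_def growth_def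
  by (auto intro!: derivative_eq_intros simp: algebra_simps)

text \<open>The margin \<open>1 / 3\<close> is needed because \<open>beta (h_k) > k\<close> when \<open>k\<close> is odd.\<close>

lemma growth'_pos:
  assumes "3 \<le> k" "2 \<le> t" "t \<le> k + 1 / 3"
  shows "0 < growth' k t"
proof -
  define S D where "S = golden_sum t" and "D = golden_diff t"
  define X where "X = 2 * (k - t) * D + 3 * D + sqrt 5 * S"
  have S: "0 < S" and D: "0 \<le> D"
    using assms golden_sum_pos golden_diff_nonneg by (auto simp: S_def D_def)
  have sqrt_S: "2236 / 1000 * S \<le> sqrt 5 * S" using sqrt_5_bounds S by (intro mult_right_mono) auto
  have "43 / 10 * S \<le> X"
  proof (cases "3 \<le> t")
    case False
    have "sqrt 5 * S \<le> 3 * D" using golden_sum_le_diff_2[OF assms(2)] by (simp add: S_def D_def)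
    moreover have "0 \<le> (k - t) * D" using False assms D by (intro mult_nonneg_nonneg) auto
    ultimately show ?thesis using sqrt_S S unfolding X_def by linarith
  next
    case True
    have "2 * S \<le> sqrt 5 * D" using golden_sum_le_diff_3[OF True] by (simp add: S_def D_def)
    also have "\<dots> \<le> 2237 / 1000 * D" using sqrt_5_bounds D by (intro mult_right_mono) auto
    finally have "2000 / 2237 * S \<le> D" by simp
    moreover have "(- 1 / 3) * D \<le> (k - t) * D" using assms D by (intro mult_right_mono) auto
    ultimately show ?thesis using sqrt_S S unfolding X_def by linarith
  qed
  then have "47 / 100 * (43 / 10 * S) \<le> ln golden * X"
    using ln_golden_bounds S by (intro mult_mono) auto
  moreover have "2 * growth' k t = ln golden * X - 2 * S"
    by (simp add: growth'_def golden_diff_add_2 X_def S_def D_def field_simps)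
  ultimately show ?thesis using S by linarith
qed

text \<open>The factor \<open>2 / 3\<close> is a lower bound for \<open>ln b\<close>, \<open>b \<ge> 2\<close>.\<close>

lemma growth''_le:
  assumes "3 \<le> k" "2 \<le> t" "t \<le> k + 1 / 3"
  shows "growth'' k t \<le> 2 / 3 * growth' k t"
proof -
  define c S D where "c = ln golden" and "S = golden_sum t" and "D = golden_diff t"
  define X where "X = 2 * ((k - t) * (c * S - 2 / 3 * D)) + 3 * (c * S) + c * (sqrt 5 * D)
    - 2 / 3 * (sqrt 5 * S) - 6 * D"
  have c: "47 / 100 \<le> c" "c \<le> 49 / 100" using ln_golden_bounds by (auto simp: c_def)
  have S: "0 < S" and D: "0 \<le> D"
    using assms golden_sum_pos golden_diff_nonneg by (auto simp: S_def D_def)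
  have sqrt_S: "2236 / 1000 * S \<le> sqrt 5 * S" using sqrt_5_bounds S by (intro mult_right_mono) auto
  have sqrt_D: "sqrt 5 * D \<le> 2237 / 1000 * D" using sqrt_5_bounds D by (intro mult_right_mono) auto
  have "sqrt 5 * S \<le> 3 * D" using golden_sum_le_diff_2[OF assms(2)] by (simp add: S_def D_def)
  with sqrt_S have S_le: "2236 / 3000 * S \<le> D" by simp
  have cS: "47 / 100 * S \<le> c * S" "c * S \<le> 49 / 100 * S"
    using c S by (intro mult_right_mono; simp)+
  have "c * (sqrt 5 * D) \<le> 49 / 100 * (2237 / 1000 * D)"
    using c D by (intro mult_mono sqrt_D) auto
  moreover have "(k - t) * (c * S - 2 / 3 * D) \<le> - 1 / 3 * (c * S - 2 / 3 * D)"
    using assms cS S_le by (intro mult_right_mono_neg) auto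
  ultimately have "X \<le> - 3 * S"
    using cS sqrt_S S_le S unfolding X_def by argo
  then have "c * X \<le> c * (- 3 * S)" using c by (intro mult_left_mono) auto
  then have "c * X \<le> - 3 * (c * S)" by simp
  moreover have "2 * (growth'' k t - 2 / 3 * growth' k t) = c * X + 4 / 3 * S"
    by (simp add: growth''_def growth'_def growth_def golden_sum_add_2 golden_diff_add_2
        X_def c_def S_def D_def field_simps)
  ultimately show ?thesis using cS S by argo
qed

lemma growth_strict_mono:
  assumes "3 \<le> k" "2 \<le> s" "s < t" "t \<le> k + 1 / 3"
  shows "growth k s < growth k t"
proof (rule DERIV_pos_imp_increasing[OF assms(3)])
  fix x assume "s \<le> x" "x \<le> t"
  with assms show "\<exists>y. (growth k has_real_derivative y) (at x) \<and> 0 < y"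
    using DERIV_growth growth'_pos[of k x] by (intro exI[of _ "growth' k x"]) auto
qed

lemma concave_on_compose_log_affine:
  fixes b c d :: real
  assumes b: "1 < b" and I: "convex I" and pos: "\<And>x. x \<in> I \<Longrightarrow> 0 < c * x + d"
    and g': "\<And>x. x \<in> I \<Longrightarrow> (g has_real_derivative g' (log b (c * x + d))) (at (log b (c * x + d)))"
    and g'': "\<And>x. x \<in> I \<Longrightarrow> (g' has_real_derivative g'' (log b (c * x + d))) (at (log b (c * x + d)))"
    and le: "\<And>x. x \<in> I \<Longrightarrow> g'' (log b (c * x + d)) \<le> ln b * g' (log b (c * x + d))"
  shows "concave_on I (\<lambda>x. g (log b (c * x + d)))"
proof (rule f''_le0_imp_concave[OF I])
  fix x assume x: "x \<in> I"
  define t where "t x = log b (c * x + d)" for x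
  define r where "r x = c / ln b / (c * x + d)" for x
  have ln_b: "0 < ln b" using b by simp
  have t: "(t has_real_derivative r x) (at x)"
    unfolding t_def[abs_def] r_def using pos[OF x] b
    by (auto intro!: derivative_eq_intros simp: field_simps)
  have "(r has_real_derivative - (c / ln b * c) / (c * x + d)\<^sup>2) (at x)"
    unfolding r_def[abs_def] using pos[OF x] ln_b
    by (auto intro!: derivative_eq_intros simp: power2_eq_square)
  moreover have "- (c / ln b * c) / (c * x + d)\<^sup>2 = - ln b * (r x)\<^sup>2"
    using ln_b by (simp add: r_def power2_eq_square)
  ultimately have r: "(r has_real_derivative - ln b * (r x)\<^sup>2) (at x)" by simp
  show "((\<lambda>x. g (log b (c * x + d))) has_real_derivative g' (t x) * r x) (at x)"
    using DERIV_chain2[OF g'[OF x, folded t_def] t] by (simp add: t_def)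
  show "((\<lambda>x. g' (t x) * r x) has_real_derivative (g'' (t x) - ln b * g' (t x)) * (r x)\<^sup>2) (at x)"
    using DERIV_mult[OF DERIV_chain2[OF g''[OF x, folded t_def] t] r]
    by (simp add: algebra_simps power2_eq_square)
  show "(g'' (t x) - ln b * g' (t x)) * (r x)\<^sup>2 \<le> 0"
    using le[OF x] by (intro mult_nonpos_nonneg) (auto simp: t_def)
qed

section \<open>The values of $f_k$ at the points $h_m$\<close>

lemma beta_log_1:
  assumes "2 \<le> b"
  shows "beta_log b 1 = 2"
  using assms log_nat_power[of "real b" "real b" 2] by (simp add: beta_log_def)

lemma beta_log_mono:
  assumes b: "2 \<le> b" and "0 \<le> x" "x \<le> y"
  shows "beta_log b x \<le> beta_log b y"
proof -
  have "0 \<le> (real b ^ 2 - 1) * x" "(real b ^ 2 - 1) * x \<le> (real b ^ 2 - 1) * y"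
    using assms by (auto intro: mult_left_mono)
  with b show ?thesis unfolding beta_log_def by (intro log_mono) auto
qed

lemma beta_log_h_num_even:
  assumes "2 \<le> b" "1 \<le> m" "even m"
  shows "beta_log b (real (h_num b m)) = real m"
  using assms by (simp add: beta_log_def h_num_closed_form log_nat_power)

lemma beta_log_h_num_odd:
  assumes "2 \<le> b" "odd m"
  shows "beta_log b (real (h_num b m)) = log (real b) (real b ^ m + (real b ^ 2 - real b))"
  using assms by (cases m) (simp_all add: beta_log_def h_num_closed_form)

lemma beta_log_h_num_odd_greater:
  assumes b: "2 \<le> b" and m: "odd m"
  shows "real m < beta_log b (real (h_num b m))"
proof -
  have "log (real b) (real b ^ m) < log (real b) (real b ^ m + (real b ^ 2 - real b))"
    using b by (intro log_less) (auto simp: power2_eq_square)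
  with b m show ?thesis by (simp add: beta_log_h_num_odd log_nat_power)
qed

lemma beta_log_h_num_odd_le:
  assumes b: "2 \<le> b" and m: "odd m" "3 \<le> m"
  shows "beta_log b (real (h_num b m)) \<le> real m + 1 / 3"
proof -
  define u where "u = real b ^ m + (real b ^ 2 - real b)"
  have u_pos: "0 < u"
    unfolding u_def using b by (intro add_pos_nonneg) (auto simp: power2_eq_square)
  have "0 \<le> real b * (real b - 2) ^ 2" by simp
  then have "4 * (real b ^ 2 - real b) \<le> real b ^ 3"
    by (simp add: algebra_simps power2_eq_square power3_eq_cube)
  also have "\<dots> \<le> real b ^ m" using b m by (intro power_increasing) auto
  finally have "u \<le> 5 / 4 * real b ^ m" by (simp add: u_def)
  then have "u ^ 3 \<le> (5 / 4 * real b ^ m) ^ 3" using u_pos by (intro power_mono) auto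
  also have "\<dots> = 125 / 64 * real b ^ (3 * m)"
    by (simp add: power_mult_distrib power_divide mult.commute flip: power_mult)
  also have "\<dots> \<le> real b * real b ^ (3 * m)" using b by (intro mult_right_mono) auto
  finally have "u ^ 3 \<le> real b ^ (3 * m + 1)" by simp
  then have "log (real b) (u ^ 3) \<le> log (real b) (real b ^ (3 * m + 1))"
    using b u_pos by (intro log_mono) auto
  also have "\<dots> = real (3 * m + 1)" using b by (subst log_nat_power) auto
  finally have "3 * log (real b) u \<le> 3 * real m + 1" using u_pos by (simp add: log_nat_power)
  with b m show ?thesis by (simp add: beta_log_h_num_odd u_def)
qed

lemma beta_log_h_num_le:
  assumes "2 \<le> b" "2 \<le> m"
  shows "beta_log b (real (h_num b m)) \<le> real m + 1 / 3"
proof (cases "even m")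
  case True
  with assms show ?thesis by (simp add: beta_log_h_num_even)
next
  case False
  with assms have "3 \<le> m" by (cases "m = 2") auto
  with assms False show ?thesis by (intro beta_log_h_num_odd_le)
qed

lemma beta_log_bounds:
  assumes "2 \<le> b" "2 \<le> k" "1 \<le> x" "x \<le> real (h_num b k)"
  shows "2 \<le> beta_log b x" "beta_log b x \<le> real k + 1 / 3"
  using assms beta_log_mono[of b 1 x] beta_log_1[of b] beta_log_mono[of b x "real (h_num b k)"]
    beta_log_h_num_le[of b k] by auto

lemma concave_on_f_bound:
  assumes b: "2 \<le> b" and k: "3 \<le> k"
  shows "concave_on {1..real (h_num b k)} (f_bound b k)"
proof -
  have "concave_on {1..real (h_num b k)}
      (\<lambda>x. growth (real k) (log (real b) ((real b ^ 2 - 1) * x + 1)))"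
  proof (rule concave_on_compose_log_affine[OF _ _ _ DERIV_growth DERIV_growth'])
    fix x assume x: "x \<in> {1..real (h_num b k)}"
    have "0 \<le> (real b ^ 2 - 1) * x" using b x by (intro mult_nonneg_nonneg) auto
    then show "0 < (real b ^ 2 - 1) * x + 1" by simp
    have t: "2 \<le> beta_log b x" "beta_log b x \<le> real k + 1 / 3"
      using beta_log_bounds[of b k x] b k x by auto
    have "ln 2 \<le> ln (real b)" using b by simp
    with ln2_ge_two_thirds have ln_b: "2 / 3 \<le> ln (real b)" by simp
    have "growth'' (real k) (beta_log b x) \<le> 2 / 3 * growth' (real k) (beta_log b x)"
      using k t by (intro growth''_le) auto
    also have "\<dots> \<le> ln (real b) * growth' (real k) (beta_log b x)"
      using growth'_pos[of "real k" "beta_log b x"] k t ln_b by (intro mult_right_mono) auto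
    finally show "growth'' (real k) (log (real b) ((real b ^ 2 - 1) * x + 1))
        \<le> ln (real b) * growth' (real k) (log (real b) ((real b ^ 2 - 1) * x + 1))"
      by (simp add: beta_log_def)
  qed (use b in auto)
  then have "concave_on {1..real (h_num b k)} (\<lambda>x. growth (real k) (beta_log b x) / sqrt 5)"
    unfolding beta_log_def by (intro concave_on_cdiv) auto
  then show ?thesis by (simp add: f_bound_eq_growth[abs_def])
qed

lemma chord_le_concave:
  assumes b: "2 \<le> b" and m: "2 \<le> m" and x: "real (h_num b m) \<le> x" "x \<le> real (h_num b (Suc m))"
    and f: "concave_on {real (h_num b m)..real (h_num b (Suc m))} f"
  shows "chord b (\<lambda>i. f (real (h_num b i))) m x \<le> f x"
proof -
  have "chord b (\<lambda>i. f (real (h_num b i))) m x = f (real (h_num b m))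
      + (f (real (h_num b (Suc m))) - f (real (h_num b m))) / h_gap b m * (x - real (h_num b m))"
    using h_gap_pos[OF b m] by (simp add: chord_def field_simps) (simp add: h_gap_def algebra_simps)
  also have "\<dots> \<le> f x" using concave_onD_Icc'[OF f, of x] x by (simp add: h_gap_def)
  finally show ?thesis .
qed

lemma sqrt_5_mult_fib:
  "sqrt 5 * real (fib n) = golden powr real n - (- 1) ^ n * golden powr (- real n)"
proof -
  have "(1 - sqrt 5) / 2 = - inverse golden"
    using inverse_golden by (simp add: golden_def field_simps)
  then have "((1 - sqrt 5) / 2) ^ n = (- 1) ^ n * golden powr (- real n)"
    using golden_gt_1
    by (simp add: powr_minus powr_realpow power_minus[of "inverse golden"] power_inverse)
  then show ?thesis
    using fib_closed_form[of n] golden_gt_1 by (simp add: golden_def[symmetric] powr_realpow)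
qed

lemma sqrt_5_mult_fib_le: "sqrt 5 * real (fib n) \<le> golden_sum (real n)"
  using golden_gt_1 by (cases "even n") (simp_all add: sqrt_5_mult_fib golden_sum_def)

lemma sqrt_5_mult_fib_less: "even n \<Longrightarrow> sqrt 5 * real (fib n) < golden_sum (real n)"
  using golden_gt_1 by (simp add: sqrt_5_mult_fib golden_sum_def)

lemma
  assumes "m \<le> k"
  shows knot_value_le_growth: "sqrt 5 * knot_value k m \<le> growth (real k) (real m)"
    and knot_value_less_growth: "even m \<Longrightarrow> sqrt 5 * knot_value k m < growth (real k) (real m)"
proof -
  have knot: "sqrt 5 * knot_value k m
      = (real k - real m) * (sqrt 5 * real (fib m)) + sqrt 5 * real (fib (m + 2))"
    by (simp add: knot_value_def algebra_simps)
  have fib_m: "(real k - real m) * (sqrt 5 * real (fib m))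
      \<le> (real k - real m) * golden_sum (real m)"
    using assms sqrt_5_mult_fib_le by (intro mult_left_mono) auto
  have m_add_2: "real (m + 2) = real m + 2" by simp
  show "sqrt 5 * knot_value k m \<le> growth (real k) (real m)"
    unfolding knot growth_def using fib_m sqrt_5_mult_fib_le[of "m + 2", unfolded m_add_2]
    by (rule add_mono)
  show "sqrt 5 * knot_value k m < growth (real k) (real m)" if "even m"
    unfolding knot growth_def using fib_m sqrt_5_mult_fib_less[of "m + 2", unfolded m_add_2] that
    by (intro add_le_less_mono) auto
qed

lemma knot_value_less_f_bound:
  assumes b: "2 \<le> b" and m: "2 \<le> m" "m \<le> k" and k: "3 \<le> k"
  shows "knot_value k m < f_bound b k (real (h_num b m))"
proof -
  have "sqrt 5 * knot_value k m < growth (real k) (beta_log b (real (h_num b m)))"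
  proof (cases "even m")
    case True
    with b m show ?thesis by (simp add: beta_log_h_num_even knot_value_less_growth)
  next
    case False
    have "sqrt 5 * knot_value k m \<le> growth (real k) (real m)"
      by (rule knot_value_le_growth[OF m(2)])
    also have "\<dots> < growth (real k) (beta_log b (real (h_num b m)))"
      using beta_log_h_num_odd_greater[OF b False] beta_log_h_num_le[OF b m(1)] m k
      by (intro growth_strict_mono) auto
    finally show ?thesis .
  qed
  then show ?thesis by (simp add: f_bound_eq_growth field_simps)
qed

theorem theorem36:
  fixes b k n :: nat
  assumes "b \<ge> 2"
    and "k \<ge> 3"
    and "b ^ k < n"
    and "n \<le> b ^ k + h_num b k"
  shows "real (over_count b n) < f_bound b k (real n - real b ^ k)"
proof -
  define x where "x = n - b ^ k"
  have n: "n = b ^ k + x" and x: "1 \<le> x" "x \<le> h_num b k" using assms by (auto simp: x_def)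
  from h_num_interval[OF assms(2) x] obtain m
    where m: "2 \<le> m" "m < k" and x_m: "h_num b m \<le> x" "x \<le> h_num b (Suc m)" by blast
  have "{real (h_num b m)..real (h_num b (Suc m))} \<subseteq> {1..real (h_num b k)}"
    using h_num_pos[of b m] h_num_mono[OF assms(1), of "Suc m" k] m by auto
  with concave_on_f_bound[OF assms(1,2)]
  have concave: "concave_on {real (h_num b m)..real (h_num b (Suc m))} (f_bound b k)"
    by (auto simp: concave_on_def intro: convex_on_subset)
  have "real (over_count b n) \<le> chord b (knot_value k) m (real x)"
    unfolding n using assms(1) m x_m
    by (intro over_count_power_add_le_chord over_count_le_chord) auto
  also have "\<dots> < chord b (\<lambda>i. f_bound b k (real (h_num b i))) m (real x)"
    using assms m x_m by (intro chord_strict_mono knot_value_less_f_bound) auto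
  also have "\<dots> \<le> f_bound b k (real x)"
    using assms(1) m x_m concave by (intro chord_le_concave) auto
  finally show ?thesis by (simp add: n)
qed

end
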